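(* Let $S\subset\mathbb Z_{>0}$ be a finite nonempty set, let $L=\mathrm{lcm}(S)$ and $Z=T_{h/L}$. Then the unique minimal denominator clearing operator for $S$, up to a Laurent unit, is $$P_S^{\min}(Z)=\mathrm{lcm}_{d\in S}\,(Z^{L/d}-1)^2.$$ If $$\mathscr C(S)=\bigcup_{d\in S}\{r\ge1:r\mid L/d\},$$ then, up to a Laurent unit, $$P_S^{\min}(Z)=\prod_{r\in\mathscr C(S)}\Phi_r(Z)^2,$$ where $\Phi_r$ is the $r$-th cyclotomic polynomial. If $1\in S$, then $P_S^{\min}(Z)=(Z^L-1)^2$ up to a Laurent unit, with symmetric representative $\Delta_1=T_h-2+T_{-h}$.
   Context: $T_a$ denotes the shift operator $T_af(t)=f(t+a)$, and $h=\lambda/(2\pi)$, so that with $Z=T_{h/L}$ one has $Z^j=T_{jh/L}$; for the purposes of divisibility $Z$ is treated as an indeterminate. A Laurent polynomial $P(Z)\in\mathbb C[Z^{\pm1}]$ is called a denominator clearing operator for $S$ if $$(Z^{L/d}-1)^2\mid P(Z)\quad\text{in }\mathbb C[Z^{\pm1}]\text{ for every }d\in S.$$ Two such operators differing by a Laurent unit $cZ^r$ ($c\in\mathbb C^\times$, $r\in\mathbb Z$) are regarded as equivalent. Minimality is with respect to divisibility in $\mathbb C[Z^{\pm1}]$ modulo these units: a denominator clearing operator is minimal if it divides every denominator clearing operator for $S$. *)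

theory Defs
  imports
    Complex_Main
    "HOL-Library.Poly_Mapping"
    "HOL-Computational_Algebra.Polynomial_Factorial"
    "HOL-Computational_Algebra.Field_as_Ring"
begin

text \<open>
  The ring of complex Laurent polynomials in \<open>Z\<close> is the group algebra of the integers: finitely
  supported maps from exponents to coefficients, with the convolution product.
\<close>

type_synonym laurent = "int \<Rightarrow>\<^sub>0 complex"

abbreviation Zpow :: "int \<Rightarrow> laurent" where
  "Zpow k \<equiv> Poly_Mapping.single k 1"

abbreviation Z :: laurent where
  "Z \<equiv> Zpow 1"

definition laurent_of_poly :: "complex poly \<Rightarrow> laurent" where
  "laurent_of_poly p = (\<Sum>i\<le>degree p. Poly_Mapping.single (int i) (coeff p i))"

definition laurent_equiv :: "laurent \<Rightarrow> laurent \<Rightarrow> bool" where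
  "laurent_equiv P Q \<longleftrightarrow> (\<exists>c r. c \<noteq> 0 \<and> P = Poly_Mapping.single r c * Q)"

definition denominator_clearing :: "nat set \<Rightarrow> laurent \<Rightarrow> bool" where
  "denominator_clearing S P \<longleftrightarrow> (\<forall>d\<in>S. (Z ^ (Lcm S div d) - 1)\<^sup>2 dvd P)"

definition minimal_denominator_clearing :: "nat set \<Rightarrow> laurent \<Rightarrow> bool" where
  "minimal_denominator_clearing S P \<longleftrightarrow>
     denominator_clearing S P \<and> (\<forall>Q. denominator_clearing S Q \<longrightarrow> P dvd Q)"

text \<open>
  The least common multiple is formed in the ordinary polynomial ring (as the normalized, i.e. monic,
  representative) and then regarded as a Laurent polynomial. Being an lcm in the
  Laurent ring means, by definition, being a minimal denominator clearing operator.
\<close>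

definition P_min :: "nat set \<Rightarrow> laurent" where
  "P_min S = laurent_of_poly (LCM d\<in>S. (monom 1 (Lcm S div d) - 1)\<^sup>2)"

definition cyclotomic :: "nat \<Rightarrow> complex poly" where
  "cyclotomic r = (\<Prod>k | k \<in> {1..r} \<and> coprime k r. [:- cis (2 * pi * real k / real r), 1:])"

definition cyclotomic_indices :: "nat set \<Rightarrow> nat set" where
  "cyclotomic_indices S = (\<Union>d\<in>S. {r. 1 \<le> r \<and> r dvd Lcm S div d})"

definition shift :: "complex \<Rightarrow> (complex \<Rightarrow> complex) \<Rightarrow> complex \<Rightarrow> complex" where
  "shift a f = (\<lambda>t. f (t + a))"

text \<open>The difference operator obtained from a Laurent polynomial by substituting the shift by \<open>a\<close>
  for \<open>Z\<close>, so that \<open>Z\<close> to the power \<open>j\<close> becomes the shift by \<open>j * a\<close>.\<close>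

definition laurent_op :: "complex \<Rightarrow> laurent \<Rightarrow> (complex \<Rightarrow> complex) \<Rightarrow> complex \<Rightarrow> complex" where
  "laurent_op a P f = (\<lambda>t. \<Sum>j\<in>Poly_Mapping.keys P. Poly_Mapping.lookup P j * shift (of_int j * a) f t)"

definition Delta1 :: "complex \<Rightarrow> (complex \<Rightarrow> complex) \<Rightarrow> complex \<Rightarrow> complex" where
  "Delta1 h f = (\<lambda>t. shift h f t - 2 * f t + shift (- h) f t)"

definition laurent_symmetric :: "laurent \<Rightarrow> bool" where
  "laurent_symmetric P \<longleftrightarrow> (\<forall>j. Poly_Mapping.lookup P (- j) = Poly_Mapping.lookup P j)"

end

theory Submission
  imports
    Defs
    "HOL-Computational_Algebra.Fundamental_Theorem_Algebra"
begin

text \<open>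
  Up to a power of \<open>Z\<close>, every nonzero Laurent polynomial is an ordinary polynomial with nonzero
  constant term, and for such polynomials divisibility in both rings agrees. Hence an ordinary lcm
  of the \<open>(Z\<^sup>n - 1)\<^sup>2\<close> is a minimal operator, and minimal operators are associated, i.e. differ by a
  monomial. Since \<open>Z\<^sup>n - 1\<close> is squarefree, the polynomials divisible by all the \<open>(Z\<^sup>n - 1)\<^sup>2\<close> are those
  vanishing to order two at every root of unity involved; writing these roots in lowest terms as
  \<open>exp (2\<pi>\<i>k/r)\<close> groups them into cyclotomic polynomials.
\<close>

section \<open>Ordinary polynomials as a subring of the Laurent ring\<close>

lemma lookup_laurent_of_poly:
  "Poly_Mapping.lookup (laurent_of_poly p) k = (if 0 \<le> k then coeff p (nat k) else 0)"
proof -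
  have "Poly_Mapping.lookup (laurent_of_poly p) k
      = (\<Sum>i\<le>degree p. if i = nat k \<and> 0 \<le> k then coeff p i else 0)"
    unfolding laurent_of_poly_def lookup_sum
    by (intro sum.cong) (auto simp: lookup_single when_def)
  then show ?thesis
    by (auto simp: coeff_eq_0)
qed

lemma inj_laurent_of_poly: "inj laurent_of_poly"
proof (rule injI, rule poly_eqI)
  fix p q :: "complex poly" and n
  assume "laurent_of_poly p = laurent_of_poly q"
  from arg_cong[OF this, of "\<lambda>P. Poly_Mapping.lookup P (int n)"]
  show "coeff p n = coeff q n"
    by (simp add: lookup_laurent_of_poly)
qed

lemma laurent_of_poly_0: "laurent_of_poly 0 = 0"
  by (simp add: laurent_of_poly_def)

lemma laurent_of_poly_add: "laurent_of_poly (p + q) = laurent_of_poly p + laurent_of_poly q"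
  by (rule poly_mapping_eqI) (simp add: lookup_laurent_of_poly lookup_add)

lemma laurent_of_poly_diff: "laurent_of_poly (p - q) = laurent_of_poly p - laurent_of_poly q"
  by (rule poly_mapping_eqI) (simp add: lookup_laurent_of_poly lookup_minus)

lemma laurent_of_poly_sum: "laurent_of_poly (sum f A) = (\<Sum>x\<in>A. laurent_of_poly (f x))"
  by (induction A rule: infinite_finite_induct) (simp_all add: laurent_of_poly_0 laurent_of_poly_add)

lemma laurent_of_poly_monom: "laurent_of_poly (monom c n) = Poly_Mapping.single (int n) c"
  by (rule poly_mapping_eqI) (auto simp: lookup_laurent_of_poly lookup_single when_def)

lemma laurent_of_poly_const: "laurent_of_poly [:c:] = Poly_Mapping.single 0 c"
  using laurent_of_poly_monom[of c 0] by (simp add: monom_0)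

lemma laurent_of_poly_1: "laurent_of_poly 1 = 1"
  using laurent_of_poly_const[of 1] by (simp add: one_pCons)

text \<open>Expanding both factors into monomials reduces the claim to adding exponents, which works
  alike in both rings.\<close>

lemma laurent_of_poly_mult: "laurent_of_poly (p * q) = laurent_of_poly p * laurent_of_poly q"
proof -
  have "p * q = (\<Sum>i\<le>degree p. monom (coeff p i) i) * (\<Sum>j\<le>degree q. monom (coeff q j) j)"
    by (simp only: poly_as_sum_of_monoms)
  also have "\<dots> = (\<Sum>i\<le>degree p. \<Sum>j\<le>degree q. monom (coeff p i * coeff q j) (i + j))"
    by (simp add: sum_product mult_monom)
  finally show ?thesis
    by (simp add: laurent_of_poly_sum laurent_of_poly_monom)
       (simp add: laurent_of_poly_def sum_product mult_single)
qed

lemma laurent_of_poly_power: "laurent_of_poly (p ^ n) = laurent_of_poly p ^ n"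
  by (induction n) (simp_all add: laurent_of_poly_1 laurent_of_poly_mult)

lemma laurent_of_poly_prod: "laurent_of_poly (prod f A) = (\<Prod>x\<in>A. laurent_of_poly (f x))"
  by (induction A rule: infinite_finite_induct) (simp_all add: laurent_of_poly_1 laurent_of_poly_mult)

lemma Z_power: "Z ^ n = Zpow (int n)"
  by (induction n) (simp_all add: mult_single add.commute)

lemma Z_power_diff_1: "(Z ^ n - 1)\<^sup>2 = laurent_of_poly ((monom 1 n - 1)\<^sup>2)"
  by (simp add: laurent_of_poly_power laurent_of_poly_diff laurent_of_poly_monom laurent_of_poly_1
      Z_power)

section \<open>Normal forms, divisibility and units of Laurent polynomials\<close>

lemma laurent_eq_Zpow_mult_poly: "\<exists>n p. P = Zpow (- int n) * laurent_of_poly p"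
proof (induction P rule: update_induct)
  case const
  show ?case
    by (rule exI[of _ 0], rule exI[of _ 0]) (simp add: laurent_of_poly_0)
next
  case (update P a b)
  then obtain n p where P: "P = Zpow (- int n) * laurent_of_poly p" by blast
  \<comment> \<open>Raising the cleared power from \<open>n\<close> to \<open>m + n\<close> makes
    the exponent of the new term nonnegative; \<open>p\<close> compensates by the factor
    \<open>monom 1 m\<close>.\<close>
  define m where "m = nat (- a)"
  have m: "0 \<le> a + int m + int n" by (simp add: m_def)
  have "Poly_Mapping.update a b P = Poly_Mapping.single a b + P"
    using update(1) by (intro poly_mapping_eqI)
      (auto simp: lookup_update lookup_add lookup_single when_def in_keys_iff)
  also have "\<dots> = Zpow (- int (m + n)) * laurent_of_poly
      (monom b (nat (a + int m + int n)) + monom 1 m * p)"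
    using m by (simp add: laurent_of_poly_add laurent_of_poly_mult laurent_of_poly_monom
        distrib_left mult_single mult.assoc[symmetric] P)
  finally show ?case by blast
qed

lemma laurent_normal_form:
  assumes "P \<noteq> 0"
  obtains k p where "P = Zpow k * laurent_of_poly p" "coeff p 0 \<noteq> 0"
proof -
  obtain n p where P: "P = Zpow (- int n) * laurent_of_poly p"
    using laurent_eq_Zpow_mult_poly by blast
  have "p \<noteq> 0"
    using assms P by (auto simp: laurent_of_poly_0)
  \<comment> \<open>Splitting off all factors \<open>Z\<close> of \<open>p\<close> leaves a cofactor
    with nonzero constant term.\<close>
  from order_decomp[OF this, of 0] obtain q
    where q: "p = [:0, 1:] ^ order 0 p * q" "\<not> [:0, 1:] dvd q" by auto
  have "p = monom 1 (order 0 p) * q"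
    using q(1) by (simp add: monom_altdef)
  then have "laurent_of_poly p = Zpow (int (order 0 p)) * laurent_of_poly q"
    by (metis laurent_of_poly_mult laurent_of_poly_monom)
  then have "P = Zpow (int (order 0 p) - int n) * laurent_of_poly q"
    by (simp add: P mult_single mult.assoc[symmetric])
  moreover have "coeff q 0 \<noteq> 0"
    using q(2) poly_eq_0_iff_dvd[of q 0] by (simp add: poly_0_coeff_0)
  ultimately show thesis using that by blast
qed

text \<open>\<open>Z\<close> is a unit among Laurent polynomials but not among ordinary ones. The
  hypothesis keeps factors \<open>Z\<close> out of the divisor, and only these make the two notions
  of divisibility differ.\<close>

lemma laurent_of_poly_dvd_iff:
  assumes "coeff p 0 \<noteq> 0"
  shows "laurent_of_poly p dvd laurent_of_poly q \<longleftrightarrow> p dvd q"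
proof
  assume "laurent_of_poly p dvd laurent_of_poly q"
  then obtain W where W: "laurent_of_poly q = laurent_of_poly p * W" by (elim dvdE)
  show "p dvd q"
  proof (cases "W = 0")
    case True
    then have "laurent_of_poly q = laurent_of_poly 0"
      by (simp add: W laurent_of_poly_0)
    then have "q = 0"
      by (rule injD[OF inj_laurent_of_poly])
    then show ?thesis by simp
  next
    case False
    then obtain k w where w: "W = Zpow k * laurent_of_poly w" "coeff w 0 \<noteq> 0"
      by (rule laurent_normal_form)
    show ?thesis
    proof (cases "0 \<le> k")
      case True
      then have "laurent_of_poly q = laurent_of_poly (p * (monom 1 (nat k) * w))"
        by (simp add: W w(1) laurent_of_poly_mult laurent_of_poly_monom)
      then show ?thesis
        using inj_laurent_of_poly by (simp add: inj_eq)
    next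
      case neg: False
      \<comment> \<open>A negative power of \<open>Z\<close> in the quotient is absurd: once
        cleared, the left side has constant term zero, but \<open>p * w\<close> does not.\<close>
      have "laurent_of_poly (monom 1 (nat (- k)) * q)
          = Zpow (- k) * Zpow k * laurent_of_poly (p * w)"
        using neg by (simp add: W w(1) laurent_of_poly_mult laurent_of_poly_monom mult_ac)
      then have "monom 1 (nat (- k)) * q = p * w"
        using inj_laurent_of_poly by (simp add: mult_single inj_eq)
      then have "coeff (monom 1 (nat (- k)) * q) 0 \<noteq> 0"
        using assms w(2) by (simp add: coeff_mult)
      then show ?thesis
        using neg by (simp add: coeff_mult)
    qed
  qed
qed (auto simp: laurent_of_poly_mult elim!: dvdE)

text \<open>The units of the Laurent ring are exactly the nonzero monomials.\<close>

lemma laurent_equiv_iff_dvd: "laurent_equiv P Q \<longleftrightarrow> P dvd Q \<and> Q dvd P"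
proof
  assume "laurent_equiv P Q"
  then obtain c r where cr: "c \<noteq> 0" "P = Poly_Mapping.single r c * Q"
    unfolding laurent_equiv_def by blast
  then have "Q = Poly_Mapping.single (- r) (inverse c) * P"
    by (simp add: mult_single mult.assoc[symmetric])
  with cr show "P dvd Q \<and> Q dvd P" by (metis dvd_triv_right)
next
  assume dvd: "P dvd Q \<and> Q dvd P"
  show "laurent_equiv P Q"
  proof (cases "P = 0")
    case True
    then show ?thesis
      using dvd by (auto simp: laurent_equiv_def intro: exI[of _ 1])
  next
    case False
    obtain U V where UV: "P = Q * U" "Q = P * V"
      using dvd by (auto elim!: dvdE)
    have "P * (V * U) = P * 1"
      using UV by (simp add: mult.assoc[symmetric])
    then have VU: "V * U = 1"
      using False mult_cancel_left by blast
    obtain a p where p: "U = Zpow a * laurent_of_poly p" "coeff p 0 \<noteq> 0"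
      using VU by (cases "U = 0") (auto intro: laurent_normal_form)
    obtain b q where q: "V = Zpow b * laurent_of_poly q" "coeff q 0 \<noteq> 0"
      using VU by (cases "V = 0") (auto intro: laurent_normal_form)
    have "V * U = (Zpow b * Zpow a) * laurent_of_poly (q * p)"
      by (simp only: p(1) q(1) laurent_of_poly_mult mult_ac)
    then have "Zpow (- a - b) * 1 = Zpow (- a - b) * (Zpow (b + a) * laurent_of_poly (q * p))"
      by (simp only: VU mult_single) simp
    then have qp: "laurent_of_poly (q * p) = Zpow (- a - b)"
      by (simp add: mult_single flip: mult.assoc)
    \<comment> \<open>A power of \<open>Z\<close> with nonzero constant term is 1, so
      \<open>p\<close> is an invertible polynomial, that is, a nonzero constant.\<close>
    have "Poly_Mapping.lookup (laurent_of_poly (q * p)) 0 \<noteq> 0"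
      using p(2) q(2) by (simp add: lookup_laurent_of_poly coeff_mult)
    then have "- a - b = 0"
      by (simp add: qp lookup_single when_def split: if_splits)
    then have "q * p = 1"
      using qp inj_laurent_of_poly by (simp add: inj_eq flip: laurent_of_poly_1)
    then have "p dvd 1"
      by (metis dvd_triv_right)
    then obtain c where c: "p = [:c:]" "c \<noteq> 0"
      by (auto simp: is_unit_poly_iff dvd_field_iff)
    then have "P = Poly_Mapping.single a c * Q"
      by (simp add: UV(1) p(1) laurent_of_poly_const mult_single mult.commute)
    then show ?thesis
      using c(2) unfolding laurent_equiv_def by blast
  qed
qed

section \<open>Minimal denominator clearing operators\<close>

lemma minimal_denominator_clearing_iff_equiv:
  assumes "minimal_denominator_clearing S P"
  shows "minimal_denominator_clearing S Q \<longleftrightarrow> laurent_equiv Q P"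
  using assms unfolding minimal_denominator_clearing_def denominator_clearing_def
    laurent_equiv_iff_dvd by (meson dvd_trans)

text \<open>The second hypothesis is the universal property of an lcm rather than a formula for it,
  so the LCM, the cyclotomic product and \<open>(monom 1 L - 1)\<^sup>2\<close> can all be
  inserted.\<close>

lemma minimal_denominator_clearing_laurent_of_poly:
  assumes R0: "coeff R 0 \<noteq> 0"
    and R: "\<And>q. R dvd q \<longleftrightarrow> (\<forall>d\<in>S. (monom 1 (Lcm S div d) - 1)\<^sup>2 dvd q)"
    and pos: "\<And>d. d \<in> S \<Longrightarrow> 0 < Lcm S div d"
  shows "minimal_denominator_clearing S (laurent_of_poly R)"
proof -
  have clear_iff: "denominator_clearing S (laurent_of_poly q) \<longleftrightarrow> R dvd q" for q
  proof -
    have "coeff ((monom 1 (Lcm S div d) - 1)\<^sup>2) 0 \<noteq> (0 :: complex)" if "d \<in> S" for d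
      using pos[OF that] by (simp add: power2_eq_square coeff_mult)
    then show ?thesis
      by (simp add: denominator_clearing_def Z_power_diff_1 R laurent_of_poly_dvd_iff)
  qed
  moreover have "laurent_of_poly R dvd Q" if Q: "denominator_clearing S Q" for Q
  proof -
    obtain n q where q: "Q = Zpow (- int n) * laurent_of_poly q"
      using laurent_eq_Zpow_mult_poly by blast
    \<comment> \<open>Multiplying \<open>Q\<close> by a power of \<open>Z\<close> preserves clearing
      and moves the question to the ordinary polynomial \<open>q\<close>.\<close>
    then have "laurent_of_poly q = Zpow (int n) * Q"
      by (simp add: mult_single mult.assoc[symmetric])
    with Q have "denominator_clearing S (laurent_of_poly q)"
      by (simp add: denominator_clearing_def)
    then show ?thesis
      by (simp add: clear_iff laurent_of_poly_dvd_iff R0 q)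
  qed
  ultimately show ?thesis
    by (simp add: minimal_denominator_clearing_def)
qed

section \<open>Roots of unity and cyclotomic factors\<close>

lemma coprime_linear_polys:
  fixes x y :: complex
  assumes "x \<noteq> y"
  shows "coprime [:- x, 1:] [:- y, 1:]"
proof (rule coprimeI)
  fix c :: "complex poly"
  assume "c dvd [:- x, 1:]" "c dvd [:- y, 1:]"
  then have "c dvd [:- x, 1:] - [:- y, 1:]"
    by (rule dvd_diff)
  also have "[:- x, 1:] - [:- y, 1:] = [:y - x:]"
    by simp
  also have "[:y - x:] dvd 1"
    using assms by (simp add: is_unit_const_poly_iff dvd_field_iff)
  finally show "c dvd 1" .
qed

text \<open>Powers of linear factors at distinct points are pairwise coprime, so divisibility can be
  tested one root at a time.\<close>

lemma prod_linear_power_dvd_iff: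
  fixes q :: "complex poly"
  assumes "finite A"
  shows "(\<Prod>z\<in>A. [:- z, 1:]) ^ n dvd q \<longleftrightarrow> (\<forall>z\<in>A. [:- z, 1:] ^ n dvd q)"
  using assms
proof (induction A)
  case (insert x A)
  have "coprime ([:- x, 1:] ^ n) ((\<Prod>z\<in>A. [:- z, 1:]) ^ n)"
    using insert(2) by (intro coprime_power_left_iff[THEN iffD2] coprime_power_right_iff[THEN iffD2]
        disjI1 prod_coprime_right coprime_linear_polys) auto
  then have "[:- x, 1:] ^ n * (\<Prod>z\<in>A. [:- z, 1:]) ^ n dvd q
      \<longleftrightarrow> [:- x, 1:] ^ n dvd q \<and> (\<Prod>z\<in>A. [:- z, 1:]) ^ n dvd q"
    by (blast intro: divides_mult dvd_mult_left dvd_mult_right)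
  with insert show ?case
    by (simp add: power_mult_distrib del: mult_pCons_left)
qed simp

text \<open>The derivative vanishes at most at 0, which is not a root, so all roots of this monic
  polynomial are simple.\<close>

lemma monom_minus_1_eq_prod_roots:
  assumes "0 < n"
  shows "monom 1 n - 1 = (\<Prod>z | z ^ n = 1. [:- z, 1 :: complex:])"
proof -
  let ?p = "monom 1 n - 1 :: complex poly"
  have "rsquarefree ?p"
    unfolding rsquarefree_roots
  proof (intro allI notI, elim conjE)
    fix a assume "poly ?p a = 0" "poly (pderiv ?p) a = 0"
    then show False
      using assms by (auto simp: poly_monom pderiv_diff pderiv_monom zero_power)
  qed
  moreover have "lead_coeff ?p = 1"
  proof -
    have "degree ?p = n"
      using assms by (subst diff_conv_add_uminus, subst degree_add_eq_left) (auto simp: degree_monom_eq)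
    then show ?thesis
      using assms by simp
  qed
  ultimately show ?thesis
    using complex_poly_decompose_rsquarefree[of ?p] by (simp add: poly_monom)
qed

text \<open>The point \<open>cis (2 * pi * x)\<close> determines \<open>x\<close> modulo 1, and a
  fraction in (0, 1] has one expression in lowest terms. Taking all \<open>r\<close> at once also
  separates the roots of different cyclotomic polynomials.\<close>

lemma inj_on_primitive_roots:
  "inj_on (\<lambda>(r, k). cis (2 * pi * real k / real r)) {(r, k). k \<in> {1..r} \<and> coprime k r}"
proof (rule inj_onI, clarify)
  fix r k s l :: nat
  assume k: "k \<in> {1..r}" "coprime k r" and l: "l \<in> {1..s}" "coprime l s"
    and eq: "cis (2 * pi * real k / real r) = cis (2 * pi * real l / real s)"
  have r: "0 < r" "0 < s" using k l by auto
  obtain n :: int where "2 * pi * real k / real r = 2 * pi * real l / real s + 2 * pi * n"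
    using eq sin_cos_eq_iff by (auto simp: complex_eq_iff)
  then have "2 * pi * (real k / real r) = 2 * pi * (real l / real s + n)"
    by (simp add: algebra_simps)
  then have n: "real k / real r = real l / real s + n"
    by (simp only: mult_cancel_left) simp
  \<comment> \<open>Both fractions lie in (0, 1], so their integer difference \<open>n\<close> is
    zero.\<close>
  have "0 < real k / real r" "real k / real r \<le> 1" "0 < real l / real s" "real l / real s \<le> 1"
    using k l by auto
  with n have "n = 0" by linarith
  with n r have "real (k * s) = real (l * r)"
    by (simp add: field_simps)
  then have "k * s = l * r"
    by (simp only: of_nat_eq_iff)
  then show "r = s \<and> k = l"
    using coprime_crossproduct_nat[of k r l s] k l by (simp add: coprime_commute)
qed

text \<open>Cancelling the gcd in the exponent \<open>j / n\<close> of a root gives lowest terms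
  with a denominator dividing \<open>n\<close>.\<close>

lemma roots_of_unity_eq_primitive_roots:
  assumes "0 < n"
  shows "{z. z ^ n = 1} = (\<lambda>(r, k). cis (2 * pi * real k / real r)) `
    (SIGMA r:{r. 1 \<le> r \<and> r dvd n}. {k \<in> {1..r}. coprime k r})" (is "_ = ?f ` ?T")
proof (intro equalityI subsetI)
  fix z :: complex assume "z \<in> {z. z ^ n = 1}"
  then obtain i where i: "i < n" "z = cis (2 * pi * real i / real n)"
    using bij_betw_roots_unity[OF assms] by (auto simp: bij_betw_def)
  \<comment> \<open>The root 1 gets index \<open>n\<close> instead of 0, since numerators run over
    \<open>{1..r}\<close>; it reduces to \<open>r = k = 1\<close>.\<close>
  define j where "j = (if i = 0 then n else i)"
  have j: "1 \<le> j" "j \<le> n" "z = cis (2 * pi * real j / real n)"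
    using i assms by (auto simp: j_def)
  define g where "g = gcd j n"
  obtain k r where kr: "j = k * g" "n = r * g" "coprime k r"
    using gcd_coprime_exists[of j n] assms unfolding g_def by (auto simp: coprime_iff_gcd_eq_1)
  have "0 < g" using assms by (simp add: g_def)
  then have "z = ?f (r, k)" "(r, k) \<in> ?T"
    using j kr by (auto simp: Suc_le_eq mult.assoc)
  then show "z \<in> ?f ` ?T" by blast
next
  fix z assume "z \<in> ?f ` ?T"
  then obtain r k where rk: "1 \<le> r" "r dvd n" "z = cis (2 * pi * real k / real r)" by auto
  then obtain m where "n = r * m" by (elim dvdE)
  then have "real n * (2 * pi * real k / real r) = 2 * pi * real (k * m)"
    using rk(1) by simp
  then have "z ^ n = cis (2 * pi * real (k * m))"
    by (simp only: rk(3) DeMoivre)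
  then show "z \<in> {z. z ^ n = 1}"
    by (simp only: cis_multiple_2pi mem_Collect_eq Ints_of_nat)
qed

text \<open>Both sides say that \<open>q\<close> vanishes to order at least two at every root of
  unity involved. A root shared by several \<open>d\<close> enters the product once, because the
  indices form a union.\<close>

lemma prod_cyclotomic_squared_dvd_iff:
  assumes "finite S" and "\<And>d. d \<in> S \<Longrightarrow> 0 < Lcm S div d"
  shows "(\<Prod>r\<in>cyclotomic_indices S. (cyclotomic r)\<^sup>2) dvd q
    \<longleftrightarrow> (\<forall>d\<in>S. (monom 1 (Lcm S div d) - 1)\<^sup>2 dvd q)"
proof -
  let ?f = "\<lambda>(r, k). cis (2 * pi * real k / real r)"
  let ?K = "\<lambda>r. {k \<in> {1..r}. coprime k r}"
  let ?T = "SIGMA r:cyclotomic_indices S. ?K r"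
  let ?A = "\<Union>d\<in>S. {z :: complex. z ^ (Lcm S div d) = 1}"
  have fin: "finite (cyclotomic_indices S)"
    using assms by (auto simp: cyclotomic_indices_def)
  have "?A = (\<Union>d\<in>S. ?f ` (SIGMA r:{r. 1 \<le> r \<and> r dvd Lcm S div d}. ?K r))"
    using roots_of_unity_eq_primitive_roots assms(2) by simp
  also have "\<dots> = ?f ` ?T"
    by (auto simp: cyclotomic_indices_def)
  finally have A: "?A = ?f ` ?T" .
  \<comment> \<open>This turns the product over pairs \<open>(r, k)\<close> into one over distinct
    points.\<close>
  have inj: "inj_on ?f ?T"
    by (rule inj_on_subset[OF inj_on_primitive_roots]) auto
  have "(\<Prod>r\<in>cyclotomic_indices S. cyclotomic r)
      = (\<Prod>(r, k)\<in>?T. [:- cis (2 * pi * real k / real r), 1:])"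
    using fin by (simp add: cyclotomic_def prod.Sigma)
  also have "\<dots> = (\<Prod>z\<in>?A. [:- z, 1:])"
    unfolding A by (subst prod.reindex[OF inj]) (simp add: case_prod_unfold)
  finally have "(\<Prod>r\<in>cyclotomic_indices S. (cyclotomic r)\<^sup>2) = (\<Prod>z\<in>?A. [:- z, 1:])\<^sup>2"
    by (simp only: prod_power_distrib[symmetric])
  moreover have "finite ?A"
    using assms by (auto intro: finite_roots_unity simp: Suc_le_eq)
  ultimately have "(\<Prod>r\<in>cyclotomic_indices S. (cyclotomic r)\<^sup>2) dvd q
      \<longleftrightarrow> (\<forall>z\<in>?A. [:- z, 1:]\<^sup>2 dvd q)"
    by (simp only: prod_linear_power_dvd_iff)
  also have "\<dots> \<longleftrightarrow> (\<forall>d\<in>S. \<forall>z\<in>{z. z ^ (Lcm S div d) = 1}. [:- z, 1:]\<^sup>2 dvd q)"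
    by blast
  also have "\<dots> \<longleftrightarrow> (\<forall>d\<in>S. (monom 1 (Lcm S div d) - 1)\<^sup>2 dvd q)"
    using assms(2) by (intro ball_cong refl)
      (simp only: monom_minus_1_eq_prod_roots prod_linear_power_dvd_iff finite_roots_unity Suc_le_eq One_nat_def)
  finally show ?thesis .
qed

text \<open>With \<open>x = monom 1 m\<close> this is the geometric sum factorization of
  \<open>x ^ k - 1\<close>.\<close>

lemma monom_minus_1_dvd:
  assumes "m dvd n"
  shows "monom 1 m - 1 dvd (monom 1 n - 1 :: complex poly)"
proof -
  obtain k where "n = m * k" using assms by (elim dvdE)
  then have "monom 1 n = (monom 1 m :: complex poly) ^ k"
    by (simp add: monom_power)
  then show ?thesis
    using power_diff_1_eq[of "monom 1 m :: complex poly" k] by simp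
qed

theorem theorem1p4:
  fixes S :: "nat set" and L :: nat and lam h :: complex
  assumes "finite S" and "S \<noteq> {}" and "\<forall>d\<in>S. 0 < d"
    and "L = Lcm S" and "h = lam / (2 * of_real pi)"
  shows "minimal_denominator_clearing S (P_min S)
    \<and> (\<forall>P. minimal_denominator_clearing S P \<longleftrightarrow> laurent_equiv P (P_min S))
    \<and> laurent_equiv (P_min S) (\<Prod>r\<in>cyclotomic_indices S. (laurent_of_poly (cyclotomic r))\<^sup>2)
    \<and> (1 \<in> S \<longrightarrow>
         laurent_equiv (P_min S) ((Z ^ L - 1)\<^sup>2)
       \<and> laurent_equiv (P_min S) (Zpow (int L) - 2 + Zpow (- int L))
       \<and> laurent_symmetric (Zpow (int L) - 2 + Zpow (- int L))
       \<and> (\<forall>f. laurent_op (h / of_nat L) (Zpow (int L) - 2 + Zpow (- int L)) f = Delta1 h f))"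
proof -
  have L: "0 < L"
    using assms by (auto intro!: Nat.gr0I simp: Lcm_0_iff)
  have pos: "0 < Lcm S div d" if "d \<in> S" for d
    using that L assms by (simp add: div_greater_zero_iff dvd_Lcm dvd_imp_le)
  \<comment> \<open>Any lcm divides the common multiple \<open>(monom 1 L - 1)\<^sup>2\<close>,
    whose constant term is 1, so its own constant term is nonzero.\<close>
  have constant_term: "coeff R 0 \<noteq> 0" if "R dvd (monom 1 L - 1)\<^sup>2" for R :: "complex poly"
  proof
    assume "coeff R 0 = 0"
    then have "coeff ((monom 1 L - 1)\<^sup>2 :: complex poly) 0 = 0"
      using that by (auto simp: coeff_mult elim!: dvdE)
    then show False
      using L by (simp add: power2_eq_square coeff_mult)
  qed
  have clear_L: "(monom 1 (Lcm S div d) - 1)\<^sup>2 dvd (monom 1 L - 1 :: complex poly)\<^sup>2" if "d \<in> S" for d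
  proof -
    have "Lcm S div d dvd L"
      using that assms(4) by (metis dvd_Lcm dvd_mult_div_cancel dvd_triv_right)
    then show ?thesis
      by (intro dvd_power_same monom_minus_1_dvd)
  qed
  have minimal: "minimal_denominator_clearing S (laurent_of_poly R)"
    if R: "\<And>q. R dvd q \<longleftrightarrow> (\<forall>d\<in>S. (monom 1 (Lcm S div d) - 1)\<^sup>2 dvd q)" for R
    using R clear_L by (intro minimal_denominator_clearing_laurent_of_poly R pos constant_term) auto
  have min: "minimal_denominator_clearing S (P_min S)"
    unfolding P_min_def by (rule minimal) (simp add: Lcm_dvd_iff)
  \<comment> \<open>By uniqueness, each closed form below need only be shown to be minimal.\<close>
  have equiv: "laurent_equiv (P_min S) P" if "minimal_denominator_clearing S P" for P
    using minimal_denominator_clearing_iff_equiv[OF that] min by blast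
  have "minimal_denominator_clearing S
      (laurent_of_poly (\<Prod>r\<in>cyclotomic_indices S. (cyclotomic r)\<^sup>2))"
    by (intro minimal prod_cyclotomic_squared_dvd_iff assms(1) pos)
  then have cyc: "laurent_equiv (P_min S) (\<Prod>r\<in>cyclotomic_indices S. (laurent_of_poly (cyclotomic r))\<^sup>2)"
    by (simp add: equiv laurent_of_poly_prod laurent_of_poly_power)
  have one: "laurent_equiv (P_min S) ((Z ^ L - 1)\<^sup>2)" if "1 \<in> S"
    unfolding Z_power_diff_1
  proof (intro equiv minimal iffI ballI)
    fix q :: "complex poly" and d assume "(monom 1 L - 1)\<^sup>2 dvd q" "d \<in> S"
    then show "(monom 1 (Lcm S div d) - 1)\<^sup>2 dvd q"
      using clear_L dvd_trans by blast
  next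
    \<comment> \<open>The instance \<open>d = 1\<close> is the claim itself, as
      \<open>Lcm S div 1 = L\<close>.\<close>
    fix q :: "complex poly" assume "\<forall>d\<in>S. (monom 1 (Lcm S div d) - 1)\<^sup>2 dvd q"
    then show "(monom 1 L - 1)\<^sup>2 dvd q"
      using that assms(4) by fastforce
  qed
  let ?D = "Zpow (int L) - 2 + Zpow (- int L)"
  have two: "(2 :: laurent) = Poly_Mapping.single 0 2"
    by simp
  \<comment> \<open>Dividing the square by the unit \<open>Zpow (int L)\<close> centres its
    exponents at 0.\<close>
  have "(Z ^ L - 1)\<^sup>2 = Zpow (int L) * ?D"
    by (simp add: Z_power power2_eq_square algebra_simps mult_single)
  moreover have "?D = Zpow (- int L) * (Zpow (int L) * ?D)"
    by (simp only: mult.assoc[symmetric] mult_single) simp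
  ultimately have "laurent_equiv ((Z ^ L - 1)\<^sup>2) ?D"
    unfolding laurent_equiv_iff_dvd by (metis dvd_triv_right)
  with one have sym_equiv: "laurent_equiv (P_min S) ?D" if "1 \<in> S"
    using that unfolding laurent_equiv_iff_dvd by (meson dvd_trans)
  \<comment> \<open>Since \<open>L\<close> is positive, the exponents \<open>L\<close>, 0 and
    \<open>- L\<close> are distinct and no coefficients merge.\<close>
  have lookup: "Poly_Mapping.lookup ?D j = (if j = 0 then - 2 else if \<bar>j\<bar> = int L then 1 else 0)" for j
    using L by (auto simp: two lookup_add lookup_minus lookup_single when_def simp del: single_numeral)
  have sym: "laurent_symmetric ?D"
    by (simp add: laurent_symmetric_def lookup)
  have keys: "Poly_Mapping.keys ?D = {int L, 0, - int L}"
    using L by (auto simp: in_keys_iff lookup split: if_splits)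
  \<comment> \<open>These exponents, times \<open>h / L\<close>, become shifts by \<open>h\<close>,
    0 and \<open>- h\<close>.\<close>
  have op: "laurent_op (h / of_nat L) ?D f = Delta1 h f" for f
    using L by (intro ext) (simp add: laurent_op_def Delta1_def keys lookup shift_def)
  show ?thesis
    using minimal_denominator_clearing_iff_equiv[OF min] min cyc one sym_equiv sym op by blast
qed

end
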